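(* For every complex number $s$ with $\operatorname{Re}(s)\ge 4.25$, we have $\nu(s)\neq 0$, where $\nu(s)=\zeta(s)\zeta''(s)-\zeta'(s)^2$.
   Context: $\zeta(s)$ denotes the Riemann zeta function, and $\zeta'$, $\zeta''$ are its first and second derivatives. The function $\nu(s)=\zeta(s)\zeta''(s)-\zeta'(s)^2$ is the numerator of $\left(\zeta'(s)/\zeta(s)\right)'=\nu(s)/\zeta(s)^2$. *)

theory Defs
  imports "HOL-Complex_Analysis.Complex_Analysis"
begin

definition zeta_series :: "complex \<Rightarrow> complex" where
  "zeta_series s = (\<Sum>n. of_nat (Suc n) powr (-s))"

(* The holomorphic continuation of the Dirichlet series to the plane without 1.
   It exists and, since - {1} is connected, is unique on - {1}, so the choice
   operator returns the same value at every such s. The case Re s > 1 is consistent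
   with it and makes the series available without first constructing the
   continuation. The value at the pole s = 1 is a dummy. *)
definition zeta :: "complex \<Rightarrow> complex" where
  "zeta s =
     (if Re s > 1 then zeta_series s
      else if s = 1 then 0
      else (SOME f. f holomorphic_on (- {1}) \<and>
                    (\<forall>z. Re z > 1 \<longrightarrow> f z = zeta_series z)) s)"

definition nu :: "complex \<Rightarrow> complex" where
  "nu s = zeta s * deriv (deriv zeta) s - (deriv zeta s)\<^sup>2"

end

(* With x = 2^(-s), the odd part (1 - x) zeta(s) = 1 + 3^(-s) + 5^(-s) + ... is so close to 1
   that crude bounds suffice. Writing N(f) = f f'' - f'^2, the identity
   N(f g) = f^2 N(g) + g^2 N(f) gives
     (1 - x)^4 nu(s) = (1 - x)^2 N(odd part) + (ln 2)^2 x (odd part)^2,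
   and the last summand dominates: the sum of (ln n)^2 n^(-s) over odd n >= 3 is at most
   (7/20) |x|. *)
theory Submission
  imports Defs
begin

section \<open>Elementary bounds for exp and ln\<close>

lemma exp_lower_Taylor_cubic:
  fixes x :: real
  assumes "0 \<le> x"
  shows "1 + x + x\<^sup>2 / 2 + x ^ 3 / 6 \<le> exp x"
  using Maclaurin_exp_le[of x 4] assms by (auto simp: eval_nat_numeral)

text \<open>The inequality ln y <= y - 1 at y = sqrt x / e gives ln x <= 2 sqrt x / e, which is
  sharp at x = e^2; then e >= 8/3 makes the constant rational.\<close>

lemma ln_squared_le:
  fixes x :: real
  assumes "x \<ge> 1"
  shows "(ln x)\<^sup>2 \<le> 9/16 * x"
proof -
  have e: "8/3 \<le> exp (1::real)"
    using exp_lower_Taylor_cubic[of 1] by simp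
  have sx: "sqrt x / exp 1 > 0"
    using assms by simp
  have "ln (sqrt x / exp 1) \<le> sqrt x / exp 1 - 1"
    using ln_le_minus_one[OF sx] .
  moreover have "ln (sqrt x / exp 1) = ln x / 2 - 1"
    using assms by (simp add: ln_div ln_sqrt)
  ultimately have "ln x \<le> 2 * (sqrt x / exp 1)"
    by linarith
  also have "sqrt x / exp 1 \<le> sqrt x / (8/3)"
    using e assms by (intro divide_left_mono) auto
  finally have "ln x \<le> 3/4 * sqrt x"
    by simp
  then have "(ln x)\<^sup>2 \<le> (3/4 * sqrt x)\<^sup>2"
    using assms by (intro power_mono) auto
  also have "\<dots> = 9/16 * x"
    using assms by (simp add: power_mult_distrib power2_eq_square)
  finally show ?thesis .
qed

text \<open>Since 2k+3 >= 3 >= e, the logarithm is at least 1. Hence one estimate, that for the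
  second derivative, serves all three series.\<close>

lemma ln_power_le:
  assumes "j \<le> 2"
  shows "ln (real (2*k+3)) ^ j \<le> (ln (real (2*k+3)))\<^sup>2"
proof (rule power_increasing)
  have "exp 1 \<le> real (2*k+3)"
    using exp_le by simp
  then show "1 \<le> ln (real (2*k+3))"
    using ln_ge_iff by simp
qed (use assms in auto)

section \<open>The series over odd n >= 3 and its termwise bounds\<close>

lemma summable_inverse_Suc_squared: "summable (\<lambda>k. inverse ((real (Suc k))\<^sup>2))"
  using inverse_power_summable[of 2, where 'a = real] by (subst summable_Suc_iff) simp

text \<open>The j-th derivative in s of n^(-s) for n = 2k+3. The term n = 1 is left out and
  reappears as the constant 1.\<close>

definition odd_term :: "nat \<Rightarrow> nat \<Rightarrow> complex \<Rightarrow> complex" where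
  "odd_term j k s = (- of_real (ln (real (2*k+3)))) ^ j * of_nat (2*k+3) powr (-s)"

lemma powr_minus_has_field_derivative:
  fixes w :: complex
  assumes "w \<noteq> 0"
  shows "((\<lambda>s. w powr (-s)) has_field_derivative - Ln w * w powr (-s)) (at s)"
  using DERIV_chain2[OF has_field_derivative_powr_right[OF assms] DERIV_minus[OF DERIV_ident]]
  by simp

lemma odd_term_deriv:
  "(odd_term j k has_field_derivative odd_term (Suc j) k s) (at s)"
proof -
  define n where "n = 2*k+3"
  have n: "n > 0"
    by (simp add: n_def)
  have L: "Ln (of_nat n) = of_real (ln (real n))"
    using Ln_of_real[of "real n"] n by simp
  have "((\<lambda>s. (- of_real (ln (real n))) ^ j * of_nat n powr (-s)) has_field_derivative
     (- of_real (ln (real n))) ^ Suc j * of_nat n powr (-s)) (at s)"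
    using n by (auto intro!: derivative_eq_intros powr_minus_has_field_derivative simp: L)
  then show ?thesis
    by (simp add: odd_term_def[abs_def] n_def)
qed

lemma norm_odd_term:
  "norm (odd_term j k s) = ln (real (2*k+3)) ^ j * real (2*k+3) powr (- Re s)"
proof -
  have "norm (of_nat (2*k+3) powr (-s)) = real (2*k+3) powr (- Re s)"
    using norm_powr_real_powr[of "of_nat (2*k+3)" "-s"] by simp
  moreover have "norm (- complex_of_real (ln (real (2*k+3)))) = ln (real (2*k+3))"
    unfolding norm_minus_cancel norm_of_real by simp
  ultimately show ?thesis
    unfolding odd_term_def norm_mult norm_power by simp
qed

lemma norm_odd_term_le:
  assumes "j \<le> 2"
  shows "norm (odd_term j k s) \<le> (ln (real (2*k+3)))\<^sup>2 * real (2*k+3) powr (- Re s)"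
  unfolding norm_odd_term using ln_power_le[OF assms] by (intro mult_right_mono) auto

text \<open>A summable majorant independent of s, as termwise differentiation requires: (ln n)^2 <=
  n costs one power of n and leaves n^(-2).\<close>

lemma norm_odd_term_le_inverse_square:
  assumes "j \<le> 2" "Re s > 4"
  shows "norm (odd_term j k s) \<le> inverse ((real (Suc k))\<^sup>2)"
proof -
  define n where "n = real (2*k+3)"
  have n: "n \<ge> 1" "n \<ge> real (Suc k)"
    by (auto simp: n_def)
  have "norm (odd_term j k s) \<le> (ln n)\<^sup>2 * n powr (- Re s)"
    using norm_odd_term_le[OF assms(1)] by (simp add: n_def)
  also have "\<dots> \<le> n * n powr (-3)"
    using ln_squared_le[of n] n assms by (intro mult_mono powr_mono) auto
  also have "\<dots> = n powr (1 + (-3))"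
    using n by (subst powr_add) auto
  also have "\<dots> = inverse (n\<^sup>2)"
    using n by (simp add: powr_minus)
  also have "\<dots> \<le> inverse ((real (Suc k))\<^sup>2)"
    using n by (intro le_imp_inverse_le power_mono) auto
  finally show ?thesis .
qed

(* A bound for (ln n)^2 (2/n)^(17/4) with n = 2k+3. For n >= 5 use (ln n)^2 <= 9n/16,
   (2/n)^(1/4) <= 4/5 and n/(n^2-1)^2 >= 1/n^3, which telescopes; this is too lossy for n = 3,
   whose term is lowered by 1/10. *)
definition odd_bound :: "nat \<Rightarrow> real" where
  "odd_bound k = 9/20 * (inverse (real (Suc k)) ^ 2 - inverse (real (Suc (Suc k))) ^ 2)
                 - (if k = 0 then 1/10 else 0)"

text \<open>Telescoping leaves 9/20, and the correction at k = 0 takes away 1/10.\<close>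

lemma odd_bound_sums: "odd_bound sums (7/20)"
proof -
  have "(\<lambda>k. inverse (real (Suc k)) ^ 2) \<longlonglongrightarrow> 0"
    using tendsto_power[OF LIMSEQ_inverse_real_of_nat, of 2] by simp
  from sums_diff[OF sums_mult[OF telescope_sums'[OF this], of "9/20"]
      sums_single[of 0 "\<lambda>_. 1/10 :: real"]]
  show ?thesis
    by (simp add: odd_bound_def[abs_def])
qed

text \<open>Here \<open>c\<close> is a rational upper bound for the fourth root of \<open>y\<close>,
  so estimates at the exponent 17/4 = 4 + 1/4 become rational arithmetic.\<close>

lemma powr_le_fourth_power:
  fixes y c \<sigma> :: real
  assumes "0 < y" "y \<le> 1" "0 < c" "y \<le> c ^ 4" "\<sigma> \<ge> 17/4"
  shows "y powr \<sigma> \<le> y ^ 4 * c"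
proof -
  have "y powr \<sigma> \<le> y powr (4 + 1/4)"
    using assms by (intro powr_mono') auto
  also have "\<dots> = y ^ 4 * y powr (1/4)"
    using assms by (subst powr_add) simp
  also have "y powr (1/4) \<le> (c ^ 4) powr (1/4)"
    using assms by (intro powr_mono2) auto
  also have "(c ^ 4) powr (1/4) = c"
    using assms powr_powr[of c 4 "1/4"] by simp
  finally show ?thesis
    using assms by simp
qed

lemma odd_term_le_odd_bound:
  assumes "j \<le> 2" "Re s \<ge> 17/4"
  shows "norm (odd_term j k s) \<le> 2 powr (- Re s) * odd_bound k"
proof -
  define n where "n = real (2*k+3)"
  have n: "n \<ge> 3"
    by (simp add: n_def)
  have "(ln n)\<^sup>2 * (2/n) powr Re s \<le> odd_bound k"
  proof (cases "k = 0")
    case True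
    \<comment> \<open>The cubic Taylor polynomial at 23/20 is about 3.065.\<close>
    have "3 \<le> exp (23/20::real)"
      using exp_lower_Taylor_cubic[of "23/20"] by (simp add: power2_eq_square power3_eq_cube)
    then have "ln 3 \<le> (23/20::real)"
      using ln_le_cancel_iff[of 3 "exp (23/20::real)"] by simp
    then have "(ln 3)\<^sup>2 \<le> (23/20::real)\<^sup>2"
      by (intro power_mono) auto
    \<comment> \<open>The fourth root of 2/3 is about 0.9036, just below 113/125 = 0.904. The
      resulting product is about 0.2362, against 0.2375 for \<open>odd_bound 0\<close>.\<close>
    moreover have "(2/3) powr Re s \<le> (2/3) ^ 4 * (113/125)"
      using assms by (intro powr_le_fourth_power) (auto simp: eval_nat_numeral)
    ultimately have "(ln 3)\<^sup>2 * (2/3) powr Re s \<le> (23/20)\<^sup>2 * ((2/3) ^ 4 * (113/125))"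
      by (intro mult_mono) auto
    also have "\<dots> \<le> odd_bound 0"
      by (simp add: odd_bound_def eval_nat_numeral)
    finally show ?thesis
      by (simp add: True n_def)
  next
    case False
    then have n5: "n \<ge> 5"
      by (simp add: n_def)
    \<comment> \<open>This uses 2/n <= 2/5 <= (4/5)^4 = 256/625.\<close>
    have "(2/n) powr Re s \<le> (2/n) ^ 4 * (4/5)"
      using n5 assms by (intro powr_le_fourth_power) (auto simp: field_simps)
    then have "(ln n)\<^sup>2 * (2/n) powr Re s \<le> (9/16 * n) * ((2/n) ^ 4 * (4/5))"
      using ln_squared_le[of n] n by (intro mult_mono) auto
    also have "\<dots> = 36/5 / n ^ 3"
      using n by (simp add: field_simps eval_nat_numeral)
    also have "\<dots> \<le> 36/5 * (n / ((n - 1)\<^sup>2 * (n + 1)\<^sup>2))"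
    proof -
      have "(n - 1)\<^sup>2 * (n + 1)\<^sup>2 = (n\<^sup>2 - 1)\<^sup>2"
        by (simp add: power2_eq_square algebra_simps)
      also have "\<dots> \<le> (n\<^sup>2)\<^sup>2"
        using n by (intro power_mono) (auto simp: self_le_power)
      also have "\<dots> = n * n ^ 3"
        by (simp add: eval_nat_numeral)
      finally show ?thesis
        using n by (simp add: field_simps)
    qed
    \<comment> \<open>By 1/(n-1)^2 - 1/(n+1)^2 = 4n/(n^2-1)^2, together with 36/5 = 9/20 * 4 *
      4.\<close>
    also have "\<dots> = odd_bound k"
    proof -
      have "n - 1 = 2 * real (Suc k)" "n + 1 = 2 * real (Suc (Suc k))"
        by (auto simp: n_def)
      then have i: "inverse (real (Suc k)) = 2 / (n - 1)" "inverse (real (Suc (Suc k))) = 2 / (n + 1)"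
        by (auto simp: field_simps)
      show ?thesis
        using n False unfolding odd_bound_def i
        by (simp add: divide_simps) (simp add: power2_eq_square algebra_simps)
    qed
    finally show ?thesis .
  qed
  moreover have "n powr (- Re s) = 2 powr (- Re s) * (2/n) powr Re s"
    using n by (simp add: powr_divide powr_minus field_simps)
  ultimately have "(ln n)\<^sup>2 * n powr (- Re s) \<le> 2 powr (- Re s) * odd_bound k"
    by (simp add: mult.left_commute)
  then show ?thesis
    using norm_odd_term_le[OF assms(1), of k s] by (simp add: n_def)
qed

lemma odd_series_le:
  assumes "j \<le> 2" "Re s \<ge> 17/4" "(\<lambda>k. odd_term j k s) sums u"
  shows "norm u \<le> 7/20 * 2 powr (- Re s)"
proof -
  have "(\<lambda>k. 2 powr (- Re s) * odd_bound k) sums (2 powr (- Re s) * (7/20))"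
    by (intro sums_mult odd_bound_sums)
  then show ?thesis
    using norm_suminf_le[of "\<lambda>k. odd_term j k s", OF odd_term_le_odd_bound[OF assms(1,2)]]
      assms(3) by (simp add: sums_iff mult.commute)
qed

section \<open>Termwise differentiation and the link with zeta\<close>

text \<open>The half-plane is open and contains the line Re s = 17/4, so derivatives are available
  on that line as well.\<close>

lemma odd_series_derivs:
  obtains u0 u1 u2 where
    "\<And>s. Re s > 4 \<Longrightarrow> (\<lambda>k. odd_term 0 k s) sums u0 s"
    "\<And>s. Re s > 4 \<Longrightarrow> (\<lambda>k. odd_term 1 k s) sums u1 s"
    "\<And>s. Re s > 4 \<Longrightarrow> (\<lambda>k. odd_term 2 k s) sums u2 s"
    "\<And>s. Re s > 4 \<Longrightarrow> (u0 has_field_derivative u1 s) (at s)"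
    "\<And>s. Re s > 4 \<Longrightarrow> (u1 has_field_derivative u2 s) (at s)"
proof -
  let ?S = "{s. Re s > 4}"
  have S: "open ?S"
    by (rule open_halfspace_Re_gt)
  have ex: "\<exists>g g'. \<forall>s\<in>?S. (\<lambda>k. odd_term j k s) sums g s \<and> (\<lambda>k. odd_term (Suc j) k s) sums g' s \<and>
      (g has_field_derivative g' s) (at s)" if "j \<le> 2" for j
  proof -
    have "\<forall>\<^sub>F k in sequentially. \<forall>s\<in>?S. norm (odd_term j k s) \<le> inverse ((real (Suc k))\<^sup>2)"
      using norm_odd_term_le_inverse_square[OF that] by (intro always_eventually) blast
    from series_and_derivative_comparison[OF S summable_inverse_Suc_squared odd_term_deriv this] show ?thesis
      by blast
  qed
  obtain u0 v where 0: "\<forall>s\<in>?S. (\<lambda>k. odd_term 0 k s) sums u0 s \<and> (\<lambda>k. odd_term 1 k s) sums v s \<and>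
      (u0 has_field_derivative v s) (at s)"
    using ex[of 0] by auto
  obtain u1 u2 where 1: "\<forall>s\<in>?S. (\<lambda>k. odd_term 1 k s) sums u1 s \<and> (\<lambda>k. odd_term 2 k s) sums u2 s \<and>
      (u1 has_field_derivative u2 s) (at s)"
    using ex[of 1] by (auto simp: numeral_2_eq_2)
  \<comment> \<open>The two applications yield separate functions for the first derivative; both are
    sums of the same series.\<close>
  have "v s = u1 s" if "Re s > 4" for s
    using 0 1 that sums_unique2 by blast
  with 0 1 show ?thesis
    by (intro that[of u0 u1 u2]) auto
qed

text \<open>The terms with even n add up to 2^(-s) zeta(s), so subtracting this leaves the terms
  with odd n.\<close>

lemma zeta_odd_part:
  assumes "Re s > 4" "(\<lambda>k. odd_term 0 k s) sums u"
  shows "(1 - 2 powr (-s)) * zeta s = 1 + u"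
proof -
  have odd: "(\<lambda>k. of_nat (2*k+1) powr (-s)) sums (1 + u)"
  proof -
    have "(\<lambda>k. of_nat (2 * Suc k + 1) powr (-s)) sums u"
      using assms(2) by (simp add: odd_term_def eval_nat_numeral)
    then show ?thesis
      using sums_Suc_iff[of "\<lambda>k. of_nat (2 * k + 1) powr (-s)" u] by (simp add: add.commute)
  qed
  have "summable (\<lambda>n. of_nat (Suc n) powr (-s))"
  proof (rule summable_comparison_test'[OF summable_inverse_Suc_squared])
    fix n :: nat
    have "norm (of_nat (Suc n) powr (-s)) = real (Suc n) powr (- Re s)"
      using norm_powr_real_powr[of "of_nat (Suc n)" "-s"] by simp
    also have "\<dots> \<le> real (Suc n) powr (-2)"
      using assms by (intro powr_mono) auto
    finally show "norm (of_nat (Suc n) powr (-s)) \<le> inverse ((real (Suc n))\<^sup>2)"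
      by (simp add: powr_minus)
  qed
  then have z: "(\<lambda>n. of_nat (Suc n) powr (-s)) sums zeta s"
    using assms by (simp add: zeta_def zeta_series_def summable_sums)
  have even: "of_nat (2*n+2) powr (-s) = 2 powr (-s) * of_nat (Suc n) powr (-s)" for n
  proof -
    \<comment> \<open>Complex powers are not multiplicative in the base in general, but they are for
      nonnegative real bases.\<close>
    have "of_nat (2*n+2) powr (-s) = (of_real 2 * of_real (real (Suc n))) powr (-s)"
      by (simp add: algebra_simps)
    also have "\<dots> = 2 powr (-s) * of_nat (Suc n) powr (-s)"
      by (subst powr_times_real) auto
    finally show ?thesis .
  qed
  have "(\<lambda>n. \<Sum>i\<in>{n*2..<n*2+2}. of_nat (Suc i) powr (-s)) sums zeta s"
    by (rule sums_group[OF z]) simp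
  moreover have "(\<Sum>i\<in>{n*2..<n*2+2}. of_nat (Suc i) powr (-s)) =
      of_nat (2*n+1) powr (-s) + 2 powr (-s) * of_nat (Suc n) powr (-s)" for n
    unfolding even[symmetric] by (simp add: mult.commute)
  ultimately have "(\<lambda>n. of_nat (2*n+1) powr (-s) + 2 powr (-s) * of_nat (Suc n) powr (-s)) sums zeta s"
    by simp
  moreover have "(\<lambda>n. of_nat (2*n+1) powr (-s) + 2 powr (-s) * of_nat (Suc n) powr (-s)) sums
      (1 + u + 2 powr (-s) * zeta s)"
    by (intro sums_add sums_mult odd z)
  ultimately have "zeta s = 1 + u + 2 powr (-s) * zeta s"
    by (rule sums_unique2)
  then show ?thesis
    by (simp add: algebra_simps)
qed

section \<open>The product identity for f f'' - f'^2\<close>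

text \<open>Differentiating g z = f twice gives the product identity, solved here for the term with
  z. As z = f/g is holomorphic, no series for its derivatives is needed.\<close>

lemma deriv_deriv_quotient:
  fixes f g :: "complex \<Rightarrow> complex"
  assumes "open S" "s \<in> S"
    and f: "\<And>w. w \<in> S \<Longrightarrow> (f has_field_derivative f1 w) (at w)"
    and f1: "\<And>w. w \<in> S \<Longrightarrow> (f1 has_field_derivative f2 w) (at w)"
    and g: "\<And>w. w \<in> S \<Longrightarrow> (g has_field_derivative g1 w) (at w)"
    and g1: "\<And>w. w \<in> S \<Longrightarrow> (g1 has_field_derivative g2 w) (at w)"
    and g0: "\<And>w. w \<in> S \<Longrightarrow> g w \<noteq> 0"
    and fgz: "\<And>w. w \<in> S \<Longrightarrow> g w * z w = f w"
  shows "(g s)\<^sup>2 * (z s * deriv (deriv z) s - (deriv z s)\<^sup>2) =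
    (f s * f2 s - (f1 s)\<^sup>2) - (z s)\<^sup>2 * (g s * g2 s - (g1 s)\<^sup>2)"
proof -
  have holo: "f holomorphic_on S" "g holomorphic_on S"
    using f g assms(1) by (auto simp: holomorphic_on_open)
  then have "(\<lambda>w. f w / g w) holomorphic_on S"
    using g0 by (intro holomorphic_on_divide) auto
  then have "z holomorphic_on S"
    by (rule holomorphic_transform) (simp add: g0 flip: fgz)
  then have z1: "(z has_field_derivative deriv z w) (at w)"
    and z2: "(deriv z has_field_derivative deriv (deriv z) w) (at w)" if "w \<in> S" for w
    using that assms(1) by (auto intro: holomorphic_derivI holomorphic_deriv)
  \<comment> \<open>This must hold on all of \<open>S\<close>, not only at \<open>s\<close>, because
    it is differentiated once more.\<close>
  have eq1: "g1 w * z w + deriv z w * g w = f1 w" if "w \<in> S" for w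
  proof (rule DERIV_unique)
    show "(f has_field_derivative g1 w * z w + deriv z w * g w) (at w)"
      by (rule has_field_derivative_transform_within_open
          [OF DERIV_mult[OF g[OF that] z1[OF that]] assms(1) that]) (rule fgz)
  qed (rule f[OF that])
  have eq2: "(g2 s * z s + deriv z s * g1 s) + (deriv (deriv z) s * g s + g1 s * deriv z s) = f2 s"
  proof (rule DERIV_unique)
    show "(f1 has_field_derivative (g2 s * z s + deriv z s * g1 s) +
        (deriv (deriv z) s * g s + g1 s * deriv z s)) (at s)"
      by (rule has_field_derivative_transform_within_open
          [OF DERIV_add[OF DERIV_mult[OF g1 z1] DERIV_mult[OF z2 g]] assms(1)])
        (use assms(2) eq1 in auto)
  qed (rule f1[OF assms(2)])
  show ?thesis
    unfolding eq2[symmetric] eq1[OF assms(2), symmetric] fgz[OF assms(2), symmetric]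
    by (simp add: power2_eq_square algebra_simps)
qed

section \<open>Comparison of both sides at a supposed zero of nu\<close>

theorem theorem1:
  fixes s :: complex
  assumes "Re s \<ge> 4.25"
  shows "nu s \<noteq> 0"
proof
  assume nu: "nu s = 0"
  let ?S = "{s. Re s > 4}"
  obtain u0 u1 u2 where u:
    "\<And>s. Re s > 4 \<Longrightarrow> (\<lambda>k. odd_term 0 k s) sums u0 s"
    "\<And>s. Re s > 4 \<Longrightarrow> (\<lambda>k. odd_term 1 k s) sums u1 s"
    "\<And>s. Re s > 4 \<Longrightarrow> (\<lambda>k. odd_term 2 k s) sums u2 s"
    and du:
    "\<And>s. Re s > 4 \<Longrightarrow> (u0 has_field_derivative u1 s) (at s)"
    "\<And>s. Re s > 4 \<Longrightarrow> (u1 has_field_derivative u2 s) (at s)"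
    using odd_series_derivs by blast
  define l :: complex where "l = of_real (ln 2)"
  have l: "Ln 2 = l"
    using Ln_of_real[of 2] by (simp add: l_def)
  have norm2: "norm (2 powr (-w) :: complex) = 2 powr (- Re w)" for w
    using norm_powr_real_powr[of 2 "-w"] by simp
  have s4: "Re s \<ge> 17/4" "Re s > 4"
    using assms by auto
  have g0: "1 - 2 powr (-w) \<noteq> (0::complex)" if "Re w > 4" for w
  proof
    assume "1 - 2 powr (-w) = (0::complex)"
    then have "norm (2 powr (-w) :: complex) = 1"
      by (metis eq_iff_diff_eq_0 norm_one)
    moreover have "2 powr (- Re w) < (2::real) powr 0"
      using that by (intro powr_less_mono) auto
    ultimately show False
      using norm2[of w] by simp
  qed
  define x :: complex where "x = 2 powr (-s)"
  define X where "X = norm x"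
  have X: "X = 2 powr (- Re s)"
    by (simp add: X_def x_def norm2)
  \<comment> \<open>The choice 16/19 slightly exceeds the fourth root of 1/2 and makes the product
    exactly 1/19.\<close>
  have "(1/2) powr Re s \<le> (1/2) ^ 4 * (16/19::real)"
    using s4 by (intro powr_le_fourth_power) (auto simp: eval_nat_numeral)
  then have X19: "X \<le> 1/19"
    unfolding X by (simp add: powr_minus powr_divide field_simps)
  have X0: "X > 0"
    by (simp add: X)
  have "(1 - x)\<^sup>2 * (zeta s * deriv (deriv zeta) s - (deriv zeta s)\<^sup>2) =
      ((1 + u0 s) * u2 s - (u1 s)\<^sup>2) - (zeta s)\<^sup>2 * ((1 - x) * (- l\<^sup>2 * x) - (l * x)\<^sup>2)"
    unfolding x_def
  proof (rule deriv_deriv_quotient[of ?S s "\<lambda>s. 1 + u0 s" u1 u2 "\<lambda>s. 1 - 2 powr (-s)" "\<lambda>s. l * 2 powr (-s)"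
         "\<lambda>s. - l\<^sup>2 * 2 powr (-s)" zeta])
    show "open ?S"
      by (rule open_halfspace_Re_gt)
  qed (use s4 in \<open>auto intro!: derivative_eq_intros powr_minus_has_field_derivative du
      zeta_odd_part u dest: g0 simp: l power2_eq_square\<close>)
  \<comment> \<open>The factor belonging to 1 - x collapses: (1 - x)(-l^2 x) - (l x)^2 = -l^2
    x.\<close>
  then have "((1 + u0 s) * u2 s - (u1 s)\<^sup>2) = - (zeta s)\<^sup>2 * l\<^sup>2 * x"
    unfolding nu[unfolded nu_def] by (simp add: algebra_simps power2_eq_square)
  \<comment> \<open>Multiplying by (1 - x)^2 lets zeta occur only as (1 - x) zeta(s), which the odd
    series replaces.\<close>
  then have "(1 - x)\<^sup>2 * ((1 + u0 s) * u2 s - (u1 s)\<^sup>2) = - ((1 - x) * zeta s)\<^sup>2 * l\<^sup>2 * x"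
    by (simp add: power_mult_distrib)
  also have "(1 - x) * zeta s = 1 + u0 s"
    unfolding x_def using s4 u by (intro zeta_odd_part) auto
  finally have eq: "norm ((1 - x)\<^sup>2 * ((1 + u0 s) * u2 s - (u1 s)\<^sup>2)) = norm (- (1 + u0 s)\<^sup>2 * l\<^sup>2 * x)"
    by (rule arg_cong)
  have U: "norm (u0 s) \<le> 7/20 * X" "norm (u1 s) \<le> 7/20 * X" "norm (u2 s) \<le> 7/20 * X"
    unfolding X using s4 by (intro odd_series_le[OF _ _ u(1)] odd_series_le[OF _ _ u(2)] odd_series_le[OF _ _ u(3)]; simp)+
  \<comment> \<open>Below, \<open>X\<close> is replaced by 1/19 everywhere except in one factor of
    each summand, so that the final comparison is linear in \<open>X\<close>.\<close>
  have "norm (1 - x) \<le> 20/19"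
    using norm_triangle_ineq4[of 1 x] X19 by (simp add: X_def)
  then have a: "(norm (1 - x))\<^sup>2 \<le> (20/19)\<^sup>2"
    by (intro power_mono) auto
  have "norm (1 + u0 s) \<le> 1 + 7/20 * (1/19)"
    using norm_triangle_ineq[of 1 "u0 s"] U(1) X19 by simp
  then have b: "norm (1 + u0 s) * norm (u2 s) \<le> (1 + 7/20 * (1/19)) * (7/20 * X)"
    using U(3) by (intro mult_mono) auto
  have "norm (u1 s) \<le> 7/20 * (1/19)"
    using U(2) X19 by simp
  then have c: "(norm (u1 s))\<^sup>2 \<le> (7/20 * (1/19)) * (7/20 * X)"
    using U(2) unfolding power2_eq_square by (intro mult_mono) auto
  have "norm ((1 - x)\<^sup>2 * ((1 + u0 s) * u2 s - (u1 s)\<^sup>2)) \<le>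
     (norm (1 - x))\<^sup>2 * (norm (1 + u0 s) * norm (u2 s) + (norm (u1 s))\<^sup>2)"
    using norm_triangle_ineq4[of "(1 + u0 s) * u2 s" "(u1 s)\<^sup>2"]
    by (simp add: norm_mult norm_power mult_left_mono)
  also have "\<dots> \<le> (20/19)\<^sup>2 * ((1 + 7/20 * (1/19)) * (7/20 * X) + (7/20 * (1/19)) * (7/20 * X))"
    by (intro mult_mono add_mono a b c) auto
  \<comment> \<open>The coefficients of \<open>X\<close> are about 0.402 and 0.428; 2/3 stands for
    ln 2.\<close>
  also have "\<dots> < (1 - 7/20 * (1/19))\<^sup>2 * (2/3)\<^sup>2 * X"
    using X0 by (simp add: power2_eq_square field_simps)
  also have "\<dots> \<le> (norm (1 + u0 s))\<^sup>2 * (ln 2)\<^sup>2 * X"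
  proof -
    have "1 - 7/20 * (1/19) \<le> norm (1 + u0 s)"
      using norm_diff_ineq[of 1 "u0 s"] U(1) X19 by simp
    then show ?thesis
      using ln2_ge_two_thirds X0 by (intro mult_mono power_mono) auto
  qed
  also have "\<dots> = norm (- (1 + u0 s)\<^sup>2 * l\<^sup>2 * x)"
    by (simp add: norm_mult norm_power X_def l_def)
  finally show False
    using eq by simp
qed

end
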